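(* Let $\mathbb{F}_q$ be a finite field with $q$ elements, let $n>1$, $1\le d<n$ be integers, and let $\alpha\in\mathbb{F}_{q^n}$ be a root of an irreducible polynomial of degree $n$ over $\mathbb{F}_q$. Let $N_d(n,q,\alpha)$ be the number of connected components of $G_d(n,q,\alpha)$. Then $$N_d(n,q,\alpha)\leq \frac{q^n-1}{\binom{|P_d|+1}{\lceil n/d\rceil-1}}.$$
   Context: A polynomial of positive degree is primary if it is a power of an irreducible polynomial. $P_d$ is the set of monic primary polynomials of degree $d$ in $\mathbb{F}_q[x]$ and $|P_d|$ its cardinality; $E_d=\{g(\alpha): g\in P_d\}$. $G_d(n,q,\alpha)$ is the directed Cayley graph with vertex set $\mathbb{F}_{q^n}^*$ and edges $\beta_1\to\beta_2$ whenever $\beta_2/\beta_1\in E_d$; its connected components are the cosets of the subgroup generated by $E_d$. *)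

theory Defs
  imports
    "Graph_Theory.Digraph_Component"
    "HOL-Library.Extended_Real"
    "HOL-Library.Cardinality"
    "HOL-Computational_Algebra.Polynomial_Factorial"
    "Jordan_Normal_Form.Matrix"
begin

(* The field F_q is a finite field type 'k, the extension F_{q^n} is a finite field type 'l
   of q^n elements together with an embedding h :: 'k \<Rightarrow> 'l (locale field_hom). *)

definition primary_poly :: "'k::field poly \<Rightarrow> bool" where
  "primary_poly g \<longleftrightarrow> degree g > 0 \<and> (\<exists>f m. irreducible f \<and> g = f ^ m)"

definition monic_primary_polys :: "nat \<Rightarrow> 'k::field poly set" where
  "monic_primary_polys d = {g. lead_coeff g = 1 \<and> primary_poly g \<and> degree g = d}"

definition primary_values :: "('k::field \<Rightarrow> 'l::field) \<Rightarrow> nat \<Rightarrow> 'l \<Rightarrow> 'l set" where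
  "primary_values h d \<alpha> = {poly (map_poly h g) \<alpha> | g. g \<in> monic_primary_polys d}"

definition primary_cayley_graph ::
    "('k::field \<Rightarrow> 'l::field) \<Rightarrow> nat \<Rightarrow> 'l \<Rightarrow> ('l, 'l \<times> 'l) pre_digraph" where
  "primary_cayley_graph h d \<alpha> =
     \<lparr> verts = {\<beta>. \<beta> \<noteq> 0},
       arcs = {(\<beta>1, \<beta>2). \<beta>1 \<noteq> 0 \<and> \<beta>2 \<noteq> 0 \<and> \<beta>2 / \<beta>1 \<in> primary_values h d \<alpha>},
       tail = fst, head = snd \<rparr>"

(* Components of a digraph are taken in the weak sense: Digraph_Component.connected refers to
   the symmetrized graph. Maximality is with respect to the subgraph relation. *)
definition connected_components :: "('a, 'b) pre_digraph \<Rightarrow> ('a, 'b) pre_digraph set" where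
  "connected_components G = {H. pre_digraph.max_subgraph G Digraph_Component.connected H}"

definition num_components :: "('k::field \<Rightarrow> 'l::field) \<Rightarrow> nat \<Rightarrow> 'l \<Rightarrow> nat" where
  "num_components h d \<alpha> = card (connected_components (primary_cayley_graph h d \<alpha>))"

(* The bound on num_components is stated in ereal because the binomial coefficient in its
   denominator can vanish (for instance q = 2, d = 1, n > 4); the quotient is then infinity,
   whereas division by 0 in type real would give 0. *)

end

(* Each component is closed under multiplication by E_d. Fix a vertex v of a component and set
   m = ceil(n/d) - 1, so that m d < n. For every set S of m elements of P_d together with the
   constant 1, the element v * (product of S)(alpha) lies in the component. The products have degree
   below n, and evaluation at alpha is injective on such polynomials; distinct elements of P_d are
   powers of non-associated irreducibles, so by unique factorization S is recovered from its product.
   Hence every component has at least binomial(|P_d| + 1, m) vertices, and the components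
   are disjoint subsets of the q^n - 1 nonzero elements. *)
theory Submission
  imports Defs "Jordan_Normal_Form.Char_Poly"
begin

section \<open>Maximal connected subgraphs\<close>

text \<open>Compatible graphs share tail and head maps, so symmetrizing arcs commutes with uniting
  them. This transfers facts on strong connectivity to weak connectivity.\<close>

lemma mk_symmetric_union:
  assumes "compatible G H"
  shows "with_proj (mk_symmetric (Digraph_Component.union G H)) =
    Digraph_Component.union (with_proj (mk_symmetric G)) (with_proj (mk_symmetric H))"
  using assms
  by (auto simp: mk_symmetric_def Digraph_Component.union_def compatible_def with_proj_def)

lemma connected_non_disj:
  assumes "wf_digraph G" "wf_digraph H" "compatible G H"
    and "Digraph_Component.connected G" "Digraph_Component.connected H"
    and "verts G \<inter> verts H \<noteq> {}"
  shows "Digraph_Component.connected (Digraph_Component.union G H)"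
proof -
  interpret G: pair_wf_digraph "mk_symmetric G"
    using assms(1) by (rule wf_digraph.wellformed_mk_symmetric)
  interpret H: pair_wf_digraph "mk_symmetric H"
    using assms(2) by (rule wf_digraph.wellformed_mk_symmetric)
  have "strongly_connected (Digraph_Component.union
      (with_proj (mk_symmetric G)) (with_proj (mk_symmetric H)))"
    using assms
    by (intro strongly_connected_non_disj G.wf_digraph_axioms H.wf_digraph_axioms)
       (auto simp: connected_def)
  then show ?thesis
    using mk_symmetric_union[OF assms(3)] by (simp add: connected_def)
qed

text \<open>Two connected graphs with a common vertex have a connected union. Here the union lies in
  \<open>G\<close> and contains \<open>H\<close>, so maximality forces it to equal
  \<open>H\<close>.\<close>

lemma max_connected_subgraph_absorbs:
  assumes H: "pre_digraph.max_subgraph G Digraph_Component.connected H"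
    and K: "subgraph K G" "Digraph_Component.connected K"
    and meet: "verts H \<inter> verts K \<noteq> {}"
  shows "subgraph K H"
proof -
  have HG: "subgraph H G" and cH: "Digraph_Component.connected H"
    using H by (auto simp: pre_digraph.max_subgraph_def)
  have wf: "wf_digraph H" "wf_digraph K" and comp: "compatible H K" "compatible H G" "compatible K G"
    using HG K by (auto simp: subgraph_def compatible_def)
  let ?U = "Digraph_Component.union H K"
  have "Digraph_Component.connected ?U"
    using wf comp(1) cH K(2) meet by (rule connected_non_disj)
  moreover have "subgraph ?U G"
    using HG comp(2) K(1) comp(3) by (rule subgraph_union)
  moreover have "subgraph H ?U" and KU: "subgraph K ?U"
    using subgraphs_of_union[OF wf comp(1)] by blast+
  ultimately have "?U = H"
    using H by (auto simp: pre_digraph.max_subgraph_def)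
  with KU show ?thesis by simp
qed

lemma max_connected_subgraphs_disjoint:
  assumes "pre_digraph.max_subgraph G Digraph_Component.connected H"
    and "pre_digraph.max_subgraph G Digraph_Component.connected K"
    and "H \<noteq> K"
  shows "verts H \<inter> verts K = {}"
proof (rule ccontr)
  assume meet: "verts H \<inter> verts K \<noteq> {}"
  have "subgraph K G" "Digraph_Component.connected K"
    using assms(2) unfolding pre_digraph.max_subgraph_def by blast+
  then have "subgraph K H"
    using meet by (rule max_connected_subgraph_absorbs[OF assms(1)])
  then have "K = H"
    by (rule pre_digraph.max_subgraph_subg_eq[OF assms(2,1)])
  with assms(3) show False by simp
qed

text \<open>The arc \<open>e\<close> with its endpoints is a subgraph of its own, connected once
  symmetrized. It meets \<open>H\<close>, so \<open>H\<close> absorbs it.\<close>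

lemma max_connected_subgraph_closed:
  assumes H: "pre_digraph.max_subgraph G Digraph_Component.connected H"
    and e: "e \<in> arcs G" "tail G e \<in> verts H"
  shows "head G e \<in> verts H"
proof -
  let ?K = "\<lparr>verts = {tail G e, head G e}, arcs = {e}, tail = tail G, head = head G\<rparr>"
  have wfG: "wf_digraph G"
    using H by (auto simp: pre_digraph.max_subgraph_def subgraph_def)
  have wfK: "wf_digraph ?K" by unfold_locales auto
  interpret K: pair_wf_digraph "mk_symmetric ?K"
    using wfK by (rule wf_digraph.wellformed_mk_symmetric)
  have "tail G e \<rightarrow>\<^bsub>mk_symmetric ?K\<^esub> head G e" "head G e \<rightarrow>\<^bsub>mk_symmetric ?K\<^esub> tail G e"
    by (auto simp: parcs_mk_symmetric)
  then have "strongly_connected (mk_symmetric ?K)"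
    by (intro strongly_connectedI) auto
  then have "Digraph_Component.connected ?K"
    by (simp add: connected_def)
  moreover have "subgraph ?K G"
    unfolding subgraph_def compatible_def
    using wfG wfK e(1) wf_digraph.wellformed[OF wfG e(1)] by simp
  moreover have "verts H \<inter> verts ?K \<noteq> {}" using e(2) by auto
  ultimately have "subgraph ?K H"
    by (intro max_connected_subgraph_absorbs[OF H])
  then have "verts ?K \<subseteq> verts H" by (rule subgraph_imp_subverts)
  then show ?thesis by simp
qed

lemma card_connected_components_mult_le:
  assumes fin: "finite (verts G)"
    and large: "\<And>H. H \<in> connected_components G \<Longrightarrow> c \<le> card (verts H)"
  shows "card (connected_components G) * c \<le> card (verts G)"
proof -
  have sub: "verts H \<subseteq> verts G" and ne: "verts H \<noteq> {}" if "H \<in> connected_components G" for H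
    using that
    by (auto simp: connected_components_def pre_digraph.max_subgraph_def subgraph_def
        connected_def strongly_connected_def)
  have disj: "verts H \<inter> verts K = {}"
    if "H \<in> connected_components G" "K \<in> connected_components G" "H \<noteq> K" for H K
    using that max_connected_subgraphs_disjoint by (auto simp: connected_components_def)
  \<comment> \<open>Components are graphs, not vertex sets. Disjointness and nonemptiness make
    \<open>verts\<close> injective on them, so there are finitely many and the disjoint union can be
    counted.\<close>
  have "inj_on verts (connected_components G)"
    by (rule inj_onI) (metis disj ne inf.idem)
  moreover have "verts ` connected_components G \<subseteq> Pow (verts G)"
    using sub by auto
  ultimately have finC: "finite (connected_components G)"
    using fin by (meson finite_Pow_iff inj_on_finite)
  have "card (connected_components G) * c \<le> (\<Sum>H\<in>connected_components G. card (verts H))"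
    using sum_bounded_below[of "connected_components G" c "\<lambda>H. card (verts H)"] large by simp
  also have "\<dots> = card (\<Union>(verts ` connected_components G))"
    using finC disj finite_subset[OF sub fin] by (subst card_UN_disjoint) auto
  also have "\<dots> \<le> card (verts G)"
    using fin sub by (intro card_mono) auto
  finally show ?thesis .
qed

section \<open>Products of primary polynomials\<close>

lemma prime_elem_dvd_prod_iff:
  assumes "finite A" "prime_elem p"
  shows "p dvd prod f A \<longleftrightarrow> (\<exists>x\<in>A. p dvd f x)"
  using assms(1)
  by induction (use assms(2) in \<open>auto simp: prime_elem_dvd_mult_iff prime_elem_not_unit\<close>)

lemma primary_poly_irreducible_factor:
  fixes g :: "'k::field poly"
  assumes "primary_poly g"
  obtains f where "irreducible f" "f dvd g"
proof -
  from assms obtain f m where "irreducible f" "g = f ^ m" "m > 0"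
    by (fastforce simp: primary_poly_def intro: gr0I)
  then show ?thesis by (intro that[of f]) auto
qed

text \<open>A shared irreducible factor fixes the base up to a unit, the degree \<open>d\<close>
  then fixes the exponent, and monicity removes the unit.\<close>

lemma monic_primary_poly_eqI:
  fixes g g' f :: "'k::field poly"
  assumes g: "g \<in> monic_primary_polys d" and g': "g' \<in> monic_primary_polys d"
    and f: "irreducible f" "f dvd g" "f dvd g'"
  shows "g = g'"
proof -
  from g obtain a m where a: "irreducible a" "g = a ^ m"
    by (auto simp: monic_primary_polys_def primary_poly_def)
  from g' obtain b k where b: "irreducible b" "g' = b ^ k"
    by (auto simp: monic_primary_polys_def primary_poly_def)
  have pf: "prime_elem f" using f(1) by (rule field_poly_irreducible_imp_prime)
  have "f dvd a" "f dvd b"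
    using f(2,3) a(2) b(2) pf prime_elem_dvd_power by blast+
  moreover have "a dvd f" "b dvd f"
    using calculation a(1) b(1) f(1) by (auto dest: irreducibleD' irreducible_not_unit)
  ultimately have ab: "a dvd b" "b dvd a" by (meson dvd_trans)+
  have nz: "a \<noteq> 0" "b \<noteq> 0" using a(1) b(1) by auto
  have deg: "degree a = degree b"
    using ab nz by (intro antisym dvd_imp_degree_le)
  \<comment> \<open>Positivity of \<open>d\<close> rules out bases of degree 0, so the exponents can
    be cancelled.\<close>
  have "m * degree a = d" "k * degree b = d" "d > 0"
    using g g' a(2) b(2) nz
    by (auto simp: monic_primary_polys_def primary_poly_def degree_power_eq mult.commute)
  with deg have "m = k" by auto
  with a(2) b(2) ab have "g dvd g'" "g' dvd g"
    by (auto intro: dvd_power_same)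
  with g g' show ?thesis
    by (intro poly_dvd_antisym) (auto simp: monic_primary_polys_def)
qed

text \<open>Adjoining the constant polynomial 1 to the primary polynomials lets subsets of one fixed
  size encode products of that many factors and of one factor fewer.\<close>

lemma prod_monic_primary_inj:
  fixes S T :: "'k::field poly set"
  assumes S: "finite S" "S \<subseteq> insert 1 (monic_primary_polys d)"
    and T: "finite T" "T \<subseteq> insert 1 (monic_primary_polys d)"
    and card: "card S = card T" and eq: "\<Prod>S = \<Prod>T"
  shows "S = T"
proof -
  \<comment> \<open>An irreducible factor of \<open>g\<close> is prime, so it divides some
    \<open>s\<close> in \<open>B\<close>. This \<open>s\<close> is not the unit 1, hence it is
    primary and equals \<open>g\<close>.\<close>
  have mem: "g \<in> B"
    if g: "g \<in> A" "g \<noteq> 1" and A: "finite A" "A \<subseteq> insert 1 (monic_primary_polys d)"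
      and B: "finite B" "B \<subseteq> insert 1 (monic_primary_polys d)" and AB: "\<Prod>A = \<Prod>B"
    for g :: "'k poly" and A B
  proof -
    have gP: "g \<in> monic_primary_polys d" using g A by auto
    then obtain f where f: "irreducible f" "f dvd g"
      by (auto simp: monic_primary_polys_def elim: primary_poly_irreducible_factor)
    have pf: "prime_elem f" using f(1) by (rule field_poly_irreducible_imp_prime)
    have "f dvd \<Prod>A" using f(2) g(1) A(1) by (auto simp: prime_elem_dvd_prod_iff[OF _ pf])
    then obtain s where s: "s \<in> B" "f dvd s"
      unfolding AB using B(1) by (auto simp: prime_elem_dvd_prod_iff[OF _ pf])
    have "s \<noteq> 1" using s(2) f(1) by (auto simp: irreducible_not_unit)
    with s B have "s \<in> monic_primary_polys d" by auto
    with gP f s have "g = s" by (intro monic_primary_poly_eqI)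
    with s show ?thesis by simp
  qed
  have "S - {1} \<subseteq> T"
    by (rule subsetI, rule mem[OF _ _ S T eq]) simp_all
  moreover have "T - {1} \<subseteq> S"
    by (rule subsetI, rule mem[OF _ _ T S eq[symmetric]]) simp_all
  ultimately have eq1: "S - {1} = T - {1}"
    by (intro equalityI) (simp_all add: subset_Diff_insert)
  \<comment> \<open>The product cannot detect the factor 1; equality of the cardinalities decides
    whether it is present.\<close>
  have split: "card A = card (A - {1}) + (if 1 \<in> A then 1 else 0)" if "finite A" for A :: "'k poly set"
    using card.remove[OF that, of 1] by simp
  have "card (T - {1}) + (if 1 \<in> S then 1 else 0) = card (T - {1}) + (if 1 \<in> T then 1 else 0)"
    using split[OF S(1)] split[OF T(1)] card unfolding eq1 by presburger
  then have "1 \<in> S \<longleftrightarrow> 1 \<in> T" by (auto split: if_splits)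
  with eq1 show ?thesis
    by (metis Diff_empty Diff_insert0 insert_Diff)
qed

section \<open>Evaluation at an element of full degree\<close>

context field_hom
begin

interpretation map_poly_hom: map_poly_idom_hom ..

text \<open>Euclidean descent: if \<open>p\<close> is nonzero, then \<open>f mod p\<close> also
  vanishes at \<alpha> and has smaller degree than \<open>p\<close> or is zero. By induction it is
  zero, so \<open>p\<close> divides \<open>f\<close>, against irreducibility.\<close>

lemma map_poly_root_eq_0:
  fixes f p :: "'a poly"
  assumes f: "irreducible f" "poly (map_poly hom f) \<alpha> = 0"
    and "degree p < degree f" "poly (map_poly hom p) \<alpha> = 0"
  shows "p = 0"
  using assms(3,4)
proof (induction "degree p" arbitrary: p rule: less_induct)
  case less
  show ?case
  proof (rule ccontr)
    assume p: "p \<noteq> 0"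
    have "map_poly hom (f mod p) = map_poly hom f - map_poly hom (f div p) * map_poly hom p"
      by (simp add: minus_div_mult_eq_mod flip: map_poly_hom.hom_mult map_poly_hom.hom_minus)
    then have root: "poly (map_poly hom (f mod p)) \<alpha> = 0"
      using f(2) less.prems by simp
    have "f mod p = 0"
    proof (rule ccontr)
      assume nz: "f mod p \<noteq> 0"
      then have "degree (f mod p) < degree p"
        using degree_mod_less[OF p, of f] by simp
      with less root nz show False by (meson order.strict_trans)
    qed
    then obtain k where k: "f = p * k" by (metis mod_eq_0_iff_dvd dvdE)
    \<comment> \<open>A unit \<open>p\<close> would be a nonzero constant without roots; a unit
      cofactor \<open>k\<close> would give \<open>p\<close> the full degree of
      \<open>f\<close>.\<close>
    from irreducibleD[OF f(1) k] show False
    proof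
      assume "is_unit p"
      then obtain c where c: "p = [:c:]" by (rule is_unit_polyE)
      with p have "c \<noteq> 0" by simp
      with c less.prems(2) show False by (simp add: map_poly_pCons_hom)
    next
      assume "is_unit k"
      then obtain c where c: "k = [:c:]" by (rule is_unit_polyE)
      with k f(1) have "c \<noteq> 0" by auto
      with c have "degree f = degree p" unfolding k by simp
      with less.prems(1) show False by simp
    qed
  qed
qed

lemma inj_on_eval_map_poly:
  fixes f :: "'a poly"
  assumes f: "irreducible f" "poly (map_poly hom f) \<alpha> = 0"
  shows "inj_on (\<lambda>p. poly (map_poly hom p) \<alpha>) {p. degree p < degree f}"
proof (rule inj_onI)
  fix p q assume "p \<in> {p. degree p < degree f}" "q \<in> {p. degree p < degree f}"
    and "poly (map_poly hom p) \<alpha> = poly (map_poly hom q) \<alpha>"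
  then have "p - q = 0"
    by (intro map_poly_root_eq_0[OF f]) (auto simp: map_poly_hom.hom_minus degree_diff_less)
  then show "p = q" by simp
qed

text \<open>The factors are multiplied in one at a time: a primary factor follows an arc of the
  graph, and the factor 1 stays in place.\<close>

lemma component_closed_prod:
  fixes f :: "'a poly" and \<alpha> :: 'b
  assumes f: "irreducible f" "poly (map_poly hom f) \<alpha> = 0" and d: "d < degree f"
    and H: "H \<in> connected_components (primary_cayley_graph hom d \<alpha>)"
    and v: "v \<in> verts H"
    and S: "finite S" "S \<subseteq> insert 1 (monic_primary_polys d)"
  shows "v * poly (map_poly hom (\<Prod>S)) \<alpha> \<in> verts H"
  using S
proof (induction S rule: finite_induct)
  case empty
  then show ?case using v by simp
next
  case (insert g S)
  let ?G = "primary_cayley_graph hom d \<alpha>"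
  let ?w = "v * poly (map_poly hom (\<Prod>S)) \<alpha>" and ?x = "poly (map_poly hom g) \<alpha>"
  have w: "?w \<in> verts H" using insert by simp
  have max: "pre_digraph.max_subgraph ?G Digraph_Component.connected H"
    using H by (simp add: connected_components_def)
  show ?case
  proof (cases "g = 1")
    case True
    with w insert.hyps show ?thesis by simp
  next
    case False
    with insert.prems have g: "g \<in> monic_primary_polys d" by simp
    then have "g \<noteq> 0" "degree g < degree f"
      using d by (auto simp: monic_primary_polys_def)
    \<comment> \<open>Since \<open>d < degree f\<close>, the value of \<open>g\<close> at \<alpha>
      is nonzero, so the arc ends at a vertex.\<close>
    then have x: "?x \<noteq> 0" using map_poly_root_eq_0[OF f] by blast
    have "verts H \<subseteq> verts ?G"
      using max by (auto simp: pre_digraph.max_subgraph_def subgraph_def)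
    with w have w0: "?w \<noteq> 0" by (auto simp: primary_cayley_graph_def)
    have "?x \<in> primary_values hom d \<alpha>" using g by (auto simp: primary_values_def)
    with w0 x have "(?w, ?w * ?x) \<in> arcs ?G"
      by (simp add: primary_cayley_graph_def)
    with max have "head ?G (?w, ?w * ?x) \<in> verts H"
      by (rule max_connected_subgraph_closed) (use w in \<open>simp add: primary_cayley_graph_def\<close>)
    then show ?thesis
      using insert.hyps by (simp add: primary_cayley_graph_def map_poly_hom.hom_mult mult_ac)
  qed
qed

lemma card_component_ge:
  fixes f :: "'a poly" and \<alpha> :: 'b
  assumes f: "irreducible f" "poly (map_poly hom f) \<alpha> = 0"
    and d: "0 < d" "d < degree f" and m: "m * d < degree f"
    and H: "H \<in> connected_components (primary_cayley_graph hom d \<alpha>)"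
    and fin: "finite (verts H)"
  shows "(card (monic_primary_polys d :: 'a poly set) + 1) choose m \<le> card (verts H)"
proof -
  let ?P = "monic_primary_polys d :: 'a poly set"
  let ?ev = "\<lambda>p. poly (map_poly hom p) \<alpha>"
  let ?C = "{S. S \<subseteq> insert 1 ?P \<and> card S = m}"
  obtain v where v: "v \<in> verts H" "v \<noteq> 0"
    using H
    by (fastforce simp: connected_components_def pre_digraph.max_subgraph_def subgraph_def
        connected_def strongly_connected_def primary_cayley_graph_def)
  have closed: "v * ?ev (\<Prod>S) \<in> verts H" if "finite S" "S \<subseteq> insert 1 ?P" for S
    using component_closed_prod[OF f d(2) H v(1) that] .
  \<comment> \<open>The base field is not assumed finite here. Singleton products embed
    \<open>?P\<close> into the finite set \<open>verts H\<close>, which gives the finiteness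
    required for counting subsets.\<close>
  have "inj_on (\<lambda>p. v * ?ev p) ?P"
    using inj_on_eval_map_poly[OF f] v(2) d(2)
    by (auto simp: inj_on_def monic_primary_polys_def)
  moreover have "(\<lambda>p. v * ?ev p) ` ?P \<subseteq> verts H"
    using closed[of "{p}" for p] by auto
  ultimately have finP: "finite ?P" using fin by (rule inj_on_finite)
  have finC: "finite S" if "S \<in> ?C" for S
    using that finP by (auto intro: finite_subset)
  have deg: "degree (\<Prod>S) < degree f" if S: "S \<in> ?C" for S
  proof -
    have "degree (\<Prod>S) \<le> (\<Sum>p\<in>S. degree p)"
      using degree_prod_sum_le[OF finC[OF S], of "\<lambda>p. p"] by (simp add: o_def)
    also have "\<dots> \<le> card S * d"
    proof -
      have "degree p \<le> d" if "p \<in> S" for p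
        using that S by (auto simp: monic_primary_polys_def)
      then show ?thesis using sum_bounded_above[of S degree d] by simp
    qed
    finally show ?thesis using m S by simp
  qed
  have "inj_on (\<lambda>S. v * ?ev (\<Prod>S)) ?C"
  proof (rule inj_onI)
    fix S T assume ST: "S \<in> ?C" "T \<in> ?C" and "v * ?ev (\<Prod>S) = v * ?ev (\<Prod>T)"
    then have eq: "\<Prod>S = \<Prod>T"
      using inj_on_eval_map_poly[OF f] deg v(2) by (auto simp: inj_on_def)
    have sub: "S \<subseteq> insert 1 ?P" "T \<subseteq> insert 1 ?P" and "card S = card T"
      using ST by simp_all
    then show "S = T"
      using prod_monic_primary_inj[OF finC[OF ST(1)] sub(1) finC[OF ST(2)] sub(2) _ eq] by simp
  qed
  moreover have "(\<lambda>S. v * ?ev (\<Prod>S)) ` ?C \<subseteq> verts H"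
    by (rule image_subsetI, rule closed, erule finC) simp
  ultimately have "card ?C \<le> card (verts H)"
    using fin by (rule card_inj_on_le)
  \<comment> \<open>Hence \<open>insert 1 ?P\<close> has exactly one element more than
    \<open>?P\<close>, the upper entry of the binomial coefficient.\<close>
  moreover have "1 \<notin> ?P" using d(1) by (auto simp: monic_primary_polys_def)
  ultimately show ?thesis using finP by (simp add: n_subsets)
qed

end

section \<open>The bound on the number of components\<close>

theorem theorem14:
  fixes h :: "'k::{finite,field} \<Rightarrow> 'l::{finite,field}"
    and \<alpha> :: 'l and q n d :: nat
  assumes "CARD('k) = q"
    and "CARD('l) = q ^ n"
    and "field_hom h"
    and "n > 1"
    and "1 \<le> d" and "d < n"
    and "\<exists>f :: 'k poly. irreducible f \<and> degree f = n \<and> poly (map_poly h f) \<alpha> = 0"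
  shows "ereal (real (num_components h d \<alpha>)) \<le>
    ereal (real q ^ n - 1) /
    ereal (real ((card (monic_primary_polys d :: 'k poly set) + 1) choose
      (nat \<lceil>real n / real d\<rceil> - 1)))"
proof -
  interpret field_hom h by fact
  obtain f :: "'k poly" where f: "irreducible f" "poly (map_poly h f) \<alpha> = 0" and n: "degree f = n"
    using assms(7) by auto
  let ?G = "primary_cayley_graph h d \<alpha>"
  define m where "m = nat \<lceil>real n / real d\<rceil> - 1"
  define C where "C = (card (monic_primary_polys d :: 'k poly set) + 1) choose m"
  have "real n / real d > 0" using assms by simp
  \<comment> \<open>A positive ceiling keeps the natural subtraction in \<open>m\<close> from
    truncating. As a ceiling exceeds its argument by less than 1, \<open>m\<close> is strictly below
    \<open>n / d\<close>.\<close>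
  then have "\<lceil>real n / real d\<rceil> > 0" by simp
  then have "real m = of_int \<lceil>real n / real d\<rceil> - 1" unfolding m_def by linarith
  then have "real m < real n / real d" by linarith
  then have "real (m * d) < real n" using assms(5) by (simp add: field_simps)
  then have m: "m * d < degree f" using n by linarith
  have "card (connected_components ?G) * C \<le> card (verts ?G)"
  proof (rule card_connected_components_mult_le)
    fix H assume "H \<in> connected_components ?G"
    then show "C \<le> card (verts H)"
      unfolding C_def using m n assms(5,6) f by (intro card_component_ge) auto
  qed simp
  also have "verts ?G = UNIV - {0}" by (auto simp: primary_cayley_graph_def)
  also have "card \<dots> = q ^ n - 1" using assms(2) by simp
  finally have le: "num_components h d \<alpha> * C \<le> q ^ n - 1" by (simp add: num_components_def)
  \<comment> \<open>A field has at least two elements, so \<open>q ^ n - 1\<close> is positive and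
    agrees in \<open>nat\<close> and \<open>real\<close>.\<close>
  have "card {0, 1 :: 'l} \<le> CARD('l)" by (intro card_mono) auto
  then have q: "q ^ n > 1" using assms(2) by simp
  define B where "B = real q ^ n - 1"
  have "real 1 < real (q ^ n)" using q by (simp only: of_nat_less_iff)
  then have B: "B > 0" by (simp add: B_def)
  have "num_components h d \<alpha> * C + 1 \<le> q ^ n" using le q by linarith
  then have "real (num_components h d \<alpha> * C + 1) \<le> real (q ^ n)" by (simp only: of_nat_le_iff)
  then have bound: "real (num_components h d \<alpha>) * real C \<le> B" by (simp add: B_def)
  have "ereal (real (num_components h d \<alpha>)) \<le> ereal B / ereal (real C)"
  \<comment> \<open>For \<open>C = 0\<close> the quotient is infinity because \<open>B > 0\<close>;
    otherwise it is an ordinary real quotient.\<close>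
  proof (cases "C = 0")
    case True
    with B show ?thesis by (simp add: divide_ereal_def)
  next
    case False
    with bound have "real (num_components h d \<alpha>) \<le> B / real C" by (simp add: pos_le_divide_eq)
    with False show ?thesis by simp
  qed
  then show ?thesis unfolding B_def C_def m_def .
qed

end
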